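(* Let $\beta_1,\beta_2>0$ be real numbers with $2\beta_1-\beta_2\geq 2\sqrt{2}\sinh 1$. Let $p$ be an analytic function in $\mathbb{D}$ with $p(0)=1$ and $$1+\beta_1 zp'(z)+\beta_2 z^2p''(z)\prec 1+\sin z.$$ Then $p(z)\prec 1+\sinh^{-1}z$.
   Context: $\mathbb{D}=\{z\in\mathbb{C}:|z|<1\}$. For functions $f,g$ analytic in $\mathbb{D}$, $f\prec g$ ($f$ is subordinate to $g$) means there is an analytic $w:\mathbb{D}\to\mathbb{C}$ with $w(0)=0$ and $|w(z)|\leq|z|$ such that $f(z)=g(w(z))$ for all $z\in\mathbb{D}$. $\sinh^{-1}z=\log(z+\sqrt{1+z^2})$ is the principal branch of the inverse hyperbolic sine, analytic on $\mathbb{D}$ with value $0$ at $0$. *)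

theory Defs
  imports "HOL-Complex_Analysis.Complex_Analysis"
begin

abbreviation unit_disc :: "complex set" where
  "unit_disc \<equiv> ball 0 1"

text \<open>
  Subordination is a relation between functions analytic in the disc, so the analyticity of both
  functions is part of the definition.
\<close>
definition subordinate :: "(complex \<Rightarrow> complex) \<Rightarrow> (complex \<Rightarrow> complex) \<Rightarrow> bool"
  (infix "\<prec>" 50) where
  "f \<prec> g \<longleftrightarrow> f analytic_on unit_disc \<and> g analytic_on unit_disc \<and>
     (\<exists>w. w analytic_on unit_disc \<and> w 0 = 0 \<and> (\<forall>z\<in>unit_disc. norm (w z) \<le> norm z) \<and>
          (\<forall>z\<in>unit_disc. f z = g (w z)))"

text \<open>
  The library function \<open>arsinh\<close> on the complex numbers is the principal branch of the inverse
  hyperbolic sine.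
\<close>
lemma arsinh_complex_eq: "arsinh z = Ln (z + csqrt (1 + z\<^sup>2))" for z :: complex
  by (simp add: arsinh_def csqrt_conv_powr add.commute)


end

(*
  Restricted to a ray t z, the expression a h + b z h' with h = p' is, up to the factor
  t powr (a / b - 1) / b, the derivative of t powr (a / b) * h (t z). Since |sin w| <= sinh 1 |w| on
  the disc and a >= sqrt 2 sinh 1, the mean value inequality yields |p'| <= 1 / sqrt 2, hence
  |p z - 1| <= |z| / sqrt 2. As sinh 1 <= sqrt 2, the function w = sinh (p - 1) then satisfies
  |w z| <= |z|, and it is the required Schwarz function.
*)
theory Submission
  imports Defs
begin

text \<open>The series of sinh has only odd exponents and nonnegative coefficients. For odd n and
  |z| \<le> 1 one has |z|^n \<le> |z|, so each term is at most |z| times the corresponding term of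
  the series at 1.\<close>

lemma norm_sinh_le:
  fixes z :: complex
  assumes "norm z \<le> 1"
  shows "norm (sinh z) \<le> sinh 1 * norm z"
proof -
  let ?f = "\<lambda>n. if even n then 0 else z ^ n /\<^sub>R fact n"
  let ?g = "\<lambda>n. if even n then 0 else (1::real) ^ n /\<^sub>R fact n"
  have g: "(\<lambda>n. ?g n * norm z) sums (sinh 1 * norm z)"
    by (intro sums_mult2 sinh_converges)
  have "norm (?f n) \<le> ?g n * norm z" for n
  proof (cases "even n")
    case False
    then have "norm z ^ n \<le> norm z ^ 1"
      using assms by (intro power_decreasing) (auto elim: oddE)
    then show ?thesis
      using False by (simp add: norm_power field_simps)
  qed simp
  then have "norm (suminf ?f) \<le> (\<Sum>n. ?g n * norm z)"
    using g by (intro norm_suminf_le) (auto dest: sums_summable)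
  then show ?thesis
    using g sums_unique[OF sinh_converges[of z]] by (simp add: sums_iff)
qed

lemma norm_sin_le:
  fixes z :: complex
  assumes "norm z \<le> 1"
  shows "norm (sin z) \<le> sinh 1 * norm z"
  using norm_sinh_le[of "\<i> * z"] assms by (simp add: sin_conv_sinh norm_mult)

text \<open>From e \<le> 3 the value is at most (3 - 1/3) / 2 = 4/3, and 16/9 \<le> 2.\<close>

lemma sinh_1_le_sqrt_2: "sinh (1::real) \<le> sqrt 2"
proof -
  have "exp (1::real) \<le> 3" by (rule exp_le)
  then have "1 / 3 \<le> exp (- 1 :: real)"
    by (simp add: exp_minus field_simps)
  with \<open>exp (1::real) \<le> 3\<close> have "sinh (1::real) \<le> 4 / 3"
    by (simp add: sinh_field_def)
  also have "4 / 3 \<le> sqrt 2"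
    by (rule real_le_rsqrt) (simp add: power2_eq_square)
  finally show ?thesis .
qed

text \<open>Rotation by -i carries the inversion and holomorphy properties of \<open>Arcsin\<close>
  over to \<open>arsinh\<close>.\<close>

lemma arsinh_complex_conv_Arcsin: "arsinh z = \<i> * Arcsin (- \<i> * z)" for z :: complex
  by (simp add: arsinh_complex_eq Arcsin_def power_mult_distrib)

lemma arsinh_sinh_complex:
  fixes z :: complex
  assumes "\<bar>Im z\<bar> < pi / 2"
  shows "arsinh (sinh z) = z"
proof -
  have "- \<i> * sinh z = sin (- \<i> * z)"
    by (simp add: sinh_conv_sin)
  then show ?thesis
    using assms Arcsin_sin[of "- \<i> * z"] by (simp add: arsinh_complex_conv_Arcsin)
qed

lemma analytic_on_arsinh_unit_disc: "(arsinh :: complex \<Rightarrow> complex) analytic_on unit_disc"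
proof -
  have "Arcsin holomorphic_on unit_disc"
    \<comment> \<open>The branch cuts of \<open>Arcsin\<close> are the real points of modulus at
      least 1, all outside the disc.\<close>
    by (rule holomorphic_on_Arcsin) (auto intro: le_less_trans[OF abs_Re_le_cmod])
  then have "Arcsin \<circ> (\<lambda>z. - \<i> * z) holomorphic_on unit_disc"
    by (intro holomorphic_on_compose_gen[where t = unit_disc] holomorphic_intros)
       (auto simp: norm_mult)
  then have "(\<lambda>z. \<i> * (Arcsin \<circ> (\<lambda>z. - \<i> * z)) z) holomorphic_on unit_disc"
    by (intro holomorphic_intros)
  then show ?thesis
    by (simp add: analytic_on_open arsinh_complex_conv_Arcsin[abs_def])
qed

lemma has_vector_derivative_along_ray:
  fixes f :: "complex \<Rightarrow> complex"
  assumes "f holomorphic_on unit_disc" "of_real t * z \<in> unit_disc"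
  shows "((\<lambda>t. f (of_real t * z)) has_vector_derivative z * deriv f (of_real t * z)) (at t)"
proof -
  have "(f has_field_derivative deriv f (of_real t * z)) (at (of_real t * z))"
    using assms by (intro holomorphic_derivI[where S = unit_disc]) auto
  moreover have "((\<lambda>t. of_real t * z) has_vector_derivative z) (at t)"
    by (auto intro!: derivative_eq_intros simp: has_vector_derivative_def scaleR_conv_of_real)
  ultimately show ?thesis
    using field_vector_diff_chain_at[of "\<lambda>t. of_real t * z" z t f] by (simp add: o_def)
qed

lemma of_real_mult_in_unit_disc:
  assumes "z \<in> unit_disc" "t \<in> {0..1}"
  shows "of_real t * z \<in> unit_disc"
  using assms mult_left_le_one_le[of "norm z" t] by (auto simp: norm_mult)

lemma continuous_on_along_ray:
  fixes f :: "complex \<Rightarrow> complex"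
  assumes "f holomorphic_on unit_disc" "z \<in> unit_disc"
  shows "continuous_on {0..1} (\<lambda>t. f (of_real t * z))"
  using assms of_real_mult_in_unit_disc
  by (intro continuous_on_compose2[OF holomorphic_on_imp_continuous_on[OF assms(1)]]
        continuous_intros) auto

text \<open>Mean value inequality on the segment from 0 to z, with majorant K |z| t. The factor u
  stays in the hypothesis because the first-order estimate on p' is delivered in that form.\<close>

lemma norm_diff_le_of_deriv_bound:
  fixes f :: "complex \<Rightarrow> complex"
  assumes hol: "f holomorphic_on unit_disc" and z: "z \<in> unit_disc"
    and bound: "\<And>u. u \<in> unit_disc \<Longrightarrow> norm (u * deriv f u) \<le> K * norm u"
  shows "norm (f z - f 0) \<le> K * norm z"
proof -
  \<comment> \<open>The endpoints are spelled out as values at t = 1 and t = 0 so that they match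
    the functions of t in the rule.\<close>
  have "norm (f (of_real 1 * z) - f (of_real 0 * z)) \<le> K * norm z * 1 - K * norm z * 0"
  proof (rule differentiable_bound_general[where f = "\<lambda>t. f (of_real t * z)"
        and \<phi> = "\<lambda>t. K * norm z * t" and f' = "\<lambda>t. z * deriv f (of_real t * z)"
        and \<phi>' = "\<lambda>_. K * norm z"])
    fix t :: real assume t: "0 < t" "t < 1"
    then have tz: "of_real t * z \<in> unit_disc"
      using of_real_mult_in_unit_disc z by simp
    show "((\<lambda>t. f (of_real t * z)) has_vector_derivative z * deriv f (of_real t * z)) (at t)"
      using hol tz by (rule has_vector_derivative_along_ray)
    show "((\<lambda>t. K * norm z * t) has_vector_derivative K * norm z) (at t)"
      by (auto intro!: derivative_eq_intros simp: has_vector_derivative_def)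
    have "t * norm (z * deriv f (of_real t * z)) \<le> t * (K * norm z)"
      using bound[OF tz] t by (simp add: norm_mult mult_ac)
    then show "norm (z * deriv f (of_real t * z)) \<le> K * norm z"
      using t by simp
  qed (auto intro!: continuous_intros continuous_on_along_ray hol z simp del: of_real_0 of_real_1)
  then show ?thesis by simp
qed

lemma norm_le_of_first_order_bound:
  fixes h :: "complex \<Rightarrow> complex" and a b M :: real
  assumes hol: "h holomorphic_on unit_disc" and z: "z \<in> unit_disc"
    and a: "a > 0" and b: "b > 0"
    and bound: "\<And>u. u \<in> unit_disc \<Longrightarrow>
      norm (u * (of_real a * h u + of_real b * u * deriv h u)) \<le> M * norm u"
  shows "norm (z * h z) \<le> M / a * norm z"
proof (cases "z = 0")
  case False
  define c where "c = a / b"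
  have c: "c > 0" using a b by (simp add: c_def)
  let ?D = "\<lambda>t. of_real t * z"
  let ?f = "\<lambda>t. (t powr c) *\<^sub>R h (?D t)"
  let ?f' = "\<lambda>t. (t powr c) *\<^sub>R (z * deriv h (?D t)) + (c * t powr (c - 1)) *\<^sub>R h (?D t)"
  \<comment> \<open>As \<open>0 powr c = 0\<close> and \<open>1 powr c = 1\<close>, this is the
    bound M / a on |h z|. Positivity of c makes the weight and the majorant continuous at t =
    0.\<close>
  have "norm (?f 1 - ?f 0) \<le> M / a * 1 powr c - M / a * 0 powr c"
  proof (rule differentiable_bound_general[where f = ?f and f' = ?f'
        and \<phi> = "\<lambda>t. M / a * t powr c" and \<phi>' = "\<lambda>t. M / a * (c * t powr (c - 1))"])
    show "continuous_on {0..1} (\<lambda>t. M / a * t powr c)"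
      using c by (intro continuous_intros continuous_on_powr') auto
    show "continuous_on {0..1} ?f"
      using c by (intro continuous_intros continuous_on_powr' continuous_on_along_ray hol z) auto
    fix t :: real assume t: "0 < t" "t < 1"
    then have tz: "?D t \<in> unit_disc"
      using of_real_mult_in_unit_disc z by simp
    have powr: "((\<lambda>t. t powr c) has_real_derivative c * t powr (c - 1)) (at t)"
      using t by (auto intro!: derivative_eq_intros)
    show "((\<lambda>t. M / a * t powr c) has_vector_derivative M / a * (c * t powr (c - 1))) (at t)"
      using DERIV_cmult[OF powr, of "M / a"]
      by (simp only: has_real_derivative_iff_has_vector_derivative)
    show "(?f has_vector_derivative ?f' t) (at t)"
      by (rule has_vector_derivative_scaleR[OF powr has_vector_derivative_along_ray[OF hol tz]])
    have "norm (?D t) * norm (of_real a * h (?D t) + of_real b * ?D t * deriv h (?D t))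
        \<le> norm (?D t) * M"
      using bound[OF tz] by (simp add: norm_mult mult_ac)
    \<comment> \<open>Cancels |t z|, which is positive because t > 0 and z is nonzero.\<close>
    then have M: "norm (of_real a * h (?D t) + of_real b * ?D t * deriv h (?D t)) \<le> M"
      using t False by simp
    have "t powr c = t powr (c - 1) * t"
      using t powr_add[of t "c - 1" 1] by simp
    \<comment> \<open>With c = a / b, pulling out \<open>t powr (c - 1) / b\<close> leaves the
      coefficient b c = a on h and b t z on its derivative.\<close>
    then have "?f' t = (t powr (c - 1) / b) *\<^sub>R
        (of_real a * h (?D t) + of_real b * ?D t * deriv h (?D t))"
      using b by (simp add: c_def scaleR_conv_of_real field_simps)
    then have "norm (?f' t) \<le> t powr (c - 1) / b * M"
      using mult_left_mono[OF M, of "t powr (c - 1) / b"] b by simp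
    also have "\<dots> = M / a * (c * t powr (c - 1))"
      using a by (simp add: c_def)
    finally show "norm (?f' t) \<le> M / a * (c * t powr (c - 1))" .
  qed simp
  then have "norm (h z) \<le> M / a" by simp
  then show ?thesis
    using mult_right_mono[of "norm (h z)" "M / a" "norm z"] by (simp add: norm_mult mult.commute)
qed simp

theorem theorem3p5:
  fixes \<beta>\<^sub>1 \<beta>\<^sub>2 :: real and p :: "complex \<Rightarrow> complex"
  assumes "\<beta>\<^sub>1 > 0" and "\<beta>\<^sub>2 > 0"
    and "2 * \<beta>\<^sub>1 - \<beta>\<^sub>2 \<ge> 2 * sqrt 2 * sinh 1"
    and "p analytic_on unit_disc" and "p 0 = 1"
    and "(\<lambda>z. 1 + of_real \<beta>\<^sub>1 * z * deriv p z + of_real \<beta>\<^sub>2 * z\<^sup>2 * deriv (deriv p) z)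
           \<prec> (\<lambda>z. 1 + sin z)"
  shows "p \<prec> (\<lambda>z. 1 + arsinh z)"
proof -
  have hol: "p holomorphic_on unit_disc" "deriv p holomorphic_on unit_disc"
    using assms(4) by (auto simp: analytic_on_open intro: holomorphic_deriv)
  obtain w where w: "\<And>z. z \<in> unit_disc \<Longrightarrow> norm (w z) \<le> norm z"
    "\<And>z. z \<in> unit_disc \<Longrightarrow>
      1 + of_real \<beta>\<^sub>1 * z * deriv p z + of_real \<beta>\<^sub>2 * z\<^sup>2 * deriv (deriv p) z = 1 + sin (w z)"
    using assms(6) unfolding subordinate_def by blast
  have bound: "norm (u * (of_real \<beta>\<^sub>1 * deriv p u + of_real \<beta>\<^sub>2 * u * deriv (deriv p) u))
      \<le> sinh 1 * norm u" if "u \<in> unit_disc" for u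
  proof -
    have "u * (of_real \<beta>\<^sub>1 * deriv p u + of_real \<beta>\<^sub>2 * u * deriv (deriv p) u) = sin (w u)"
      using w(2)[OF that] by (simp add: algebra_simps power2_eq_square)
    also have "norm \<dots> \<le> sinh 1 * norm (w u)"
      using w(1)[OF that] that by (intro norm_sin_le) auto
    also have "\<dots> \<le> sinh 1 * norm u"
      using w(1)[OF that] by (intro mult_left_mono) auto
    finally show ?thesis .
  qed
  \<comment> \<open>The first-order estimate for h = p', with a = \<open>\<beta>\<^sub>1\<close>, b
    = \<open>\<beta>\<^sub>2\<close> and M = sinh 1.\<close>
  have deriv_bound: "norm (u * deriv p u) \<le> sinh 1 / \<beta>\<^sub>1 * norm u" if "u \<in> unit_disc" for u
    using norm_le_of_first_order_bound[OF hol(2) that assms(1,2) bound] .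
  \<comment> \<open>Since \<open>\<beta>\<^sub>2\<close> is positive, the third assumption yields
    \<open>\<beta>\<^sub>1\<close> \<ge> sqrt 2 * sinh 1.\<close>
  have "sinh 1 / \<beta>\<^sub>1 \<le> 1 / sqrt 2"
    using assms(1-3) by (simp add: field_simps)
  then have p_bound: "norm (p z - 1) \<le> norm z / sqrt 2" if "z \<in> unit_disc" for z
    using norm_diff_le_of_deriv_bound[OF hol(1) that deriv_bound] assms(5)
      mult_right_mono[of "sinh 1 / \<beta>\<^sub>1" "1 / sqrt 2" "norm z"] by simp
  \<comment> \<open>This serves twice: it admits p z - 1 as an argument of the sinh estimate, and it
    keeps p z - 1 in the strip where \<open>arsinh\<close> inverts sinh.\<close>
  have p_lt_1: "norm (p z - 1) < 1" if "z \<in> unit_disc" for z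
  proof -
    have "norm z / sqrt 2 \<le> norm z"
      by (simp add: divide_le_eq mult_le_cancel_left1)
    then show ?thesis
      using p_bound[OF that] that by simp
  qed
  \<comment> \<open>Obtained by solving p = 1 + arsinh W for W.\<close>
  define W where "W = (\<lambda>z. sinh (p z - 1))"
  have "W holomorphic_on unit_disc"
    unfolding W_def sinh_field_def by (intro holomorphic_intros hol) auto
  moreover have "W 0 = 0"
    by (simp add: W_def assms(5))
  moreover have "norm (W z) \<le> norm z" if "z \<in> unit_disc" for z
  proof -
    have "norm (W z) \<le> sinh 1 * norm (p z - 1)"
      unfolding W_def using p_lt_1[OF that] by (intro norm_sinh_le) simp
    \<comment> \<open>The factor 1 / sqrt 2 gained for p - 1 absorbs the loss sinh 1 \<le> sqrt
      2.\<close>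
    also have "\<dots> \<le> sqrt 2 * (norm z / sqrt 2)"
      using p_bound[OF that] sinh_1_le_sqrt_2 by (intro mult_mono) auto
    finally show ?thesis by simp
  qed
  moreover have "p z = 1 + arsinh (W z)" if "z \<in> unit_disc" for z
  proof -
    \<comment> \<open>The imaginary part is below 1 in absolute value, and 1 < 3/2 < pi/2.\<close>
    have "\<bar>Im (p z - 1)\<bar> < pi / 2"
      using abs_Im_le_cmod[of "p z - 1"] p_lt_1[OF that] pi_gt3 by linarith
    then show ?thesis
      by (simp only: W_def arsinh_sinh_complex) simp
  qed
  moreover have "(\<lambda>z. 1 + arsinh z :: complex) analytic_on unit_disc"
    by (intro analytic_intros analytic_on_arsinh_unit_disc)
  ultimately show ?thesis
    unfolding subordinate_def using assms(4) by (auto simp: analytic_on_open)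
qed

end
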